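(* Let $h$ denote the meromorphic continuation to $\mathbb{C}$ of $h(s)=\sum_{n=1}^\infty H_n n^{-s}$ ($\operatorname{Re} s>1$). For every integer $m\ge 2$, in a neighborhood of $s=1-2m$, $$h(s) = \frac{\zeta(1-2m)}{s+2m-1} + (2m-1)!\,A_{2m} - \psi(2m)\zeta(1-2m) + O(s+2m-1),$$ and in a neighborhood of $s=-1$, $$h(s) = \frac{-1}{12(s+1)} - \frac{1}{8} - \frac{\gamma}{12} + O(s+1).$$ Here $\zeta$ is the Riemann zeta function, $\psi=\Gamma'/\Gamma$, $\gamma$ is the Euler constant, and $$A_n = \sum_{\substack{k+j=n\\ k\ge 1,\ j\ge 0}} \frac{B(k)}{k!\,k}\,\frac{B(j)}{j!}.$$
   Context: $H_n = 1+\frac12+\cdots+\frac1n$ are the harmonic numbers. The series for $h(s)$ converges for $\operatorname{Re} s>1$ and extends meromorphically to $\mathbb{C}$. $B_m$ are the Bernoulli numbers with $\frac{z}{e^z-1}=\sum_{m\ge0}B_m\frac{z^m}{m!}$ (so $B_1=-\frac12$), and $B(m)=B_m$ for $m\ne1$, while $B(1)=-B_1=\frac12$. Equivalently, $\frac{ze^z}{e^z-1}\log\left(\frac{e^z-1}{z}\right)=\sum_{n\ge1}A_nz^n$ near $z=0$. The Euler constant is $\gamma=-\psi(1)$. *)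

theory Defs
  imports
    "HOL-Complex_Analysis.Complex_Analysis"
    "HOL-Computational_Algebra.Formal_Power_Series"
    "HOL-Library.Landau_Symbols"
begin

definition meromorphic_continuation_of_dirichlet_series ::
    "(complex \<Rightarrow> complex) \<Rightarrow> (nat \<Rightarrow> complex) \<Rightarrow> bool" where
  "meromorphic_continuation_of_dirichlet_series f a \<longleftrightarrow>
     f nicely_meromorphic_on UNIV \<and>
     (\<forall>s. Re s > 1 \<longrightarrow> (\<lambda>n. a (Suc n) * of_nat (Suc n) powr (-s)) sums f s)"

text \<open>
  A nicely meromorphic function is continuous away from its poles and has value 0 at its poles.
  This convention makes the continuation unique as a total function, so that the definite
  descriptions below are meaningful.
\<close>

lemma nicely_meromorphic_eqI:
  assumes f: "f nicely_meromorphic_on UNIV" and g: "g nicely_meromorphic_on UNIV"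
    and eq: "\<And>s. Re s > 1 \<Longrightarrow> f s = g s"
  shows "f = g"
proof -
  define d where "d = (\<lambda>z. f z - g z)"
  have d: "d meromorphic_on UNIV"
    using f g unfolding d_def nicely_meromorphic_on_def by (auto intro: meromorphic_on_diff)
  have "eventually (\<lambda>z. d z = 0) (at 2)"
  proof -
    have "open {s. Re s > 1}" by (rule open_halfspace_Re_gt)
    then have "eventually (\<lambda>z. z \<in> {s. Re s > 1}) (nhds (2::complex))"
      by (intro eventually_nhds_in_open) auto
    then have "eventually (\<lambda>z. z \<in> {s. Re s > 1}) (at (2::complex))"
      by (simp add: eventually_nhds_conv_at)
    then show ?thesis
      by eventually_elim (use eq in \<open>auto simp: d_def\<close>)
  qed
  then have freq: "frequently (\<lambda>z. d z = 0) (at 2)"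
    by (intro eventually_frequently) auto
  have "eventually (\<lambda>z. d z = 0) (cosparse UNIV) \<or> eventually (\<lambda>z. d z \<noteq> 0) (cosparse UNIV)"
    by (rule meromorphic_imp_constant_or_avoid[OF d]) auto
  then have near: "eventually (\<lambda>w. d w = 0) (at z)" for z
    using freq by (auto simp: eventually_cosparse_open_eq frequently_def)
  show ?thesis
  proof
    fix z
    have fg: "eventually (\<lambda>w. f w = g w) (at z)"
      using near[of z] by eventually_elim (auto simp: d_def)
    have pole: "is_pole f z \<longleftrightarrow> is_pole g z"
      by (rule is_pole_cong) (use fg in auto)
    have lim: "(f \<longlongrightarrow> c) (at z) \<longleftrightarrow> (g \<longlongrightarrow> c) (at z)" for c
      by (rule filterlim_cong) (use fg in auto)
    have nolim: "\<not> (is_pole f z \<and> (f \<longlongrightarrow> c) (at z))" for c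
      unfolding is_pole_def using not_tendsto_and_filterlim_at_infinity[of "at z" f c] by auto
    have "(is_pole f z \<and> f z = 0) \<or> (f \<longlongrightarrow> f z) (at z)"
         "(is_pole g z \<and> g z = 0) \<or> (g \<longlongrightarrow> g z) (at z)"
      using f g unfolding nicely_meromorphic_on_def by auto
    then show "f z = g z"
      using pole lim nolim tendsto_unique[of "at z" f "f z" "g z"] by auto
  qed
qed

lemma meromorphic_continuation_of_dirichlet_series_unique:
  assumes "meromorphic_continuation_of_dirichlet_series f a"
    and "meromorphic_continuation_of_dirichlet_series g a"
  shows "f = g"
  using assms unfolding meromorphic_continuation_of_dirichlet_series_def
  by (intro nicely_meromorphic_eqI) (auto intro: sums_unique2)

definition zeta :: "complex \<Rightarrow> complex" where
  "zeta = (THE f. meromorphic_continuation_of_dirichlet_series f (\<lambda>n. 1))"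

definition harmonic_zeta :: "complex \<Rightarrow> complex" where
  "harmonic_zeta = (THE f. meromorphic_continuation_of_dirichlet_series f harm)"

text \<open>
  \<open>bernoulli\<close> has \<open>bernoulli 1 = -1/2\<close>, as given by the generating function
  \<open>z / (exp z - 1)\<close>; \<open>bernoulli_plus\<close> differs from it only in \<open>bernoulli_plus 1 = 1/2\<close>.
\<close>

definition bernoulli :: "nat \<Rightarrow> complex" where
  "bernoulli m = fact m * fps_nth (fps_X / (fps_exp 1 - 1)) m"

definition bernoulli_plus :: "nat \<Rightarrow> complex" where
  "bernoulli_plus m = (if m = 1 then - bernoulli 1 else bernoulli m)"

definition A_coeff :: "nat \<Rightarrow> complex" where
  "A_coeff n = (\<Sum>(k, j)\<in>{(k, j). k + j = n \<and> k \<ge> 1}.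
     bernoulli_plus k / (fact k * of_nat k) * (bernoulli_plus j / fact j))"

end

theory Submission
  imports Defs
begin

text \<open>
  Applying the Euler--Maclaurin formula of order \<open>M\<close> to \<open>x powr (-s)\<close> on each interval \<open>[n, n + 1]\<close> and
  summing against weights \<open>a n\<close> gives, after summation by parts, an identity
  \<open>(s - 1) * (\<Sum>n. a n * n powr (-s)) =
    (\<Sum>i<M. B(i) / i! * pochhammer (s - 1) i * D (s + i - 1)) + (\<Sum>n. a n * em_term M s n)\<close>,
  where \<open>D\<close> is the Dirichlet series with coefficients \<open>a n - a (n - 1)\<close>. The error series converges for
  \<open>Re s > 3 - M\<close>, so the continuation of \<open>D\<close> yields that of the original series. Weights \<open>1\<close> give
  \<open>\<zeta>\<close> with \<open>D = 1\<close>, weights \<open>H\<^sub>n\<close> give \<open>h\<close> with \<open>D s = \<zeta> (s + 1)\<close>. The error terms contain the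
  factor \<open>pochhammer (s - 1) M\<close> and vanish at \<open>s = 1 - 2 * m\<close> for large \<open>M\<close>; there, the term \<open>i = 2 * m\<close>
  contributes the pole and, through \<open>\<zeta> (1 + w) = 1 / w + \<gamma> + O(w)\<close>, the digamma value, while the
  terms \<open>i < 2 * m\<close> are values of \<open>\<zeta>\<close> at nonpositive integers and add up to \<open>(2 * m - 1)! * A_coeff (2 * m)\<close>.
\<close>

section \<open>Bernoulli numbers and the Euler--Maclaurin error term\<close>

text \<open>Division of formal power series is exact only under divisibility; here it holds since
  \<open>fps_exp 1 - 1\<close> has subdegree 1, the same as \<open>fps_X\<close>.\<close>

lemma fps_exp_minus_one_times_bernoulli:
  "(fps_exp 1 - 1) * (fps_X / (fps_exp 1 - 1)) = (fps_X :: complex fps)"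
proof -
  have ne: "fps_exp 1 - 1 \<noteq> (0 :: complex fps)"
  proof
    assume "fps_exp 1 - 1 = (0 :: complex fps)"
    then have "fps_nth (fps_exp 1 - 1 :: complex fps) 1 = 0" by simp
    then show False by simp
  qed
  have sd: "subdegree (fps_exp 1 - 1 :: complex fps) = 1"
    by (rule subdegreeI) auto
  have "(fps_exp 1 - 1 :: complex fps) dvd fps_X"
    unfolding fps_dvd_iff [OF ne fps_X_neq_zero] sd by simp
  then show ?thesis
    by simp
qed

lemma bernoulli_fps_nth: "fps_nth (fps_X / (fps_exp 1 - 1)) i = bernoulli i / fact i"
  by (simp add: bernoulli_def)

text \<open>Coefficient comparison in \<open>B * exp X = X + B\<close>, with \<open>B\<close> the
  generating series of the Bernoulli numbers.\<close>

lemma bernoulli_rec: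
  "(\<Sum>i\<le>n. bernoulli i / fact i * (1 / fact (n - i))) = (if n = 1 then 1 else 0) + bernoulli n / fact n"
proof -
  have "(fps_X / (fps_exp 1 - 1)) * fps_exp 1 = fps_X + fps_X / (fps_exp 1 - 1 :: complex fps)"
    using fps_exp_minus_one_times_bernoulli by (simp add: algebra_simps)
  then have "fps_nth ((fps_X / (fps_exp 1 - 1)) * fps_exp 1) n
      = fps_nth (fps_X + fps_X / (fps_exp 1 - 1 :: complex fps)) n" by simp
  then show ?thesis
    by (simp add: fps_mult_nth bernoulli_fps_nth atLeast0AtMost)
qed

lemma bernoulli_0: "bernoulli 0 = 1"
  and bernoulli_1: "bernoulli 1 = -1/2"
  and bernoulli_2: "bernoulli 2 = 1/6"
proof -
  show b0: "bernoulli 0 = 1"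
    using bernoulli_rec[of 1] by simp
  show b1: "bernoulli 1 = -1/2"
  proof -
    have "1 + bernoulli 1 * 2 = 0"
      using bernoulli_rec[of 2] b0 by (simp add: numeral_2_eq_2)
    then show ?thesis by algebra
  qed
  show "bernoulli 2 = 1/6"
  proof -
    have "6 + (bernoulli 1 * 18 + bernoulli 2 * 18) = 0"
      using bernoulli_rec[of 3] b0 by (simp add: numeral_2_eq_2 numeral_3_eq_3 field_simps fact_numeral)
    then show ?thesis unfolding b1 by algebra
  qed
qed

text \<open>The coefficients of \<open>X * exp X / (exp X - 1)\<close>. With the value
  \<open>1/2\<close> at index 1, the Euler--Maclaurin sum over \<open>[n, n + 1]\<close> produces
  the value at \<open>n\<close> without a separate correction term.\<close>

definition bern_coeff :: "nat \<Rightarrow> complex" where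
  "bern_coeff i = bernoulli_plus i / fact i"

lemma bern_coeff_eq: "bern_coeff i = bernoulli i / fact i + (if i = 1 then 1 else 0)"
  by (simp add: bern_coeff_def bernoulli_plus_def bernoulli_1 [simplified])

lemma bern_coeff_convolution: "(\<Sum>i\<le>n. bernoulli i / fact i * (1 / fact (n - i))) = bern_coeff n"
  unfolding bernoulli_rec bern_coeff_eq by simp

lemma bern_coeff_simps: "bern_coeff 0 = 1" "bern_coeff (Suc 0) = 1/2" "bern_coeff 2 = 1/12"
  by (simp_all add: bern_coeff_eq bernoulli_0 bernoulli_1 [simplified] bernoulli_2)

text \<open>With \<open>f\<close> the Bernoulli series, multiplying
  \<open>(exp (-X) - 1) * f (-X) = -X\<close> by \<open>exp X\<close> and cancelling
  \<open>1 - exp X\<close> yields \<open>f (-X) = f X + X\<close>.\<close>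

lemma bern_coeff_uminus: "(-1) ^ i * bern_coeff i = bernoulli i / fact i"
proof -
  define f :: "complex fps" where "f = fps_X / (fps_exp 1 - 1)"
  have f: "(fps_exp 1 - 1) * f = fps_X"
    using fps_exp_minus_one_times_bernoulli by (simp add: f_def)
  define g where "g = f oo (-fps_X)"
  have "((fps_exp 1 - 1) oo (-fps_X)) * g = (fps_X :: complex fps) oo (-fps_X)"
    unfolding g_def f [symmetric] by (rule fps_compose_mult_distrib [symmetric]) simp
  then have "(fps_exp (-1) - 1) * g = - (fps_X :: complex fps)"
    by (simp add: fps_compose_sub_distrib)
  then have "fps_exp 1 * ((fps_exp (-1) - 1) * g) = - (fps_exp 1 * (fps_X :: complex fps))"
    by simp
  then have "(1 - fps_exp 1) * g = - (fps_exp 1 * (fps_X :: complex fps))"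
    by (simp add: fps_exp_add_mult [symmetric] algebra_simps flip: mult.assoc)
  also have "\<dots> = (1 - fps_exp 1) * (f + fps_X)"
    using f by (simp add: algebra_simps)
  finally have "(1 - fps_exp 1) * g = (1 - fps_exp 1) * (f + fps_X)" .
  moreover have "1 - fps_exp 1 \<noteq> (0 :: complex fps)"
  proof
    assume "1 - fps_exp 1 = (0 :: complex fps)"
    then have "fps_nth (1 - fps_exp 1 :: complex fps) 1 = 0" by simp
    then show False by simp
  qed
  ultimately have "g = f + fps_X"
    by simp
  then have "fps_nth g i = fps_nth (f + fps_X) i" by simp
  then have "(-1) ^ i * (bernoulli i / fact i) = bern_coeff i"
    by (simp add: g_def fps_compose_uminus' f_def bernoulli_fps_nth bern_coeff_eq)
  then show ?thesis
    by (metis (no_types, lifting) left_minus_one_mult_self)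
qed

section \<open>Bernoulli polynomials divided by \<open>i!\<close>, and the Euler--Maclaurin error
  term\<close>

definition bern_pol :: "nat \<Rightarrow> complex \<Rightarrow> complex" where
  "bern_pol i x = (\<Sum>j\<le>i. bernoulli j / fact j * (x ^ (i - j) / fact (i - j)))"

lemma bern_pol_0: "bern_pol i 0 = bernoulli i / fact i"
proof -
  have "bern_pol i 0 = (\<Sum>j\<le>i. if j = i then bernoulli j / fact j else 0)"
    unfolding bern_pol_def by (rule sum.cong) (auto simp: power_0_left)
  then show ?thesis by simp
qed

lemma bern_pol_1: "bern_pol i 1 = bern_coeff i"
  by (simp add: bern_pol_def flip: bern_coeff_convolution)

lemma bern_pol_zero_index [simp]: "bern_pol 0 x = 1"
  by (simp add: bern_pol_def bernoulli_0)

lemma has_field_derivative_bern_pol_Suc: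
  "(bern_pol (Suc i) has_field_derivative bern_pol i x) (at x)"
proof -
  have "((\<lambda>x. bernoulli j / fact j * (x ^ (Suc i - j) / fact (Suc i - j))) has_field_derivative
          bernoulli j / fact j * (x ^ (i - j) / fact (i - j))) (at x)" if "j \<le> i" for j
  proof -
    have e: "Suc i - j = Suc (i - j)" using that by simp
    have "((\<lambda>x. bernoulli j / fact j * (x ^ Suc (i - j) / fact (Suc (i - j)))) has_field_derivative
        bernoulli j / fact j * (of_nat (Suc (i - j)) * x ^ (i - j) / fact (Suc (i - j)))) (at x)"
      using DERIV_power [OF DERIV_ident, where x = x and s = UNIV and n = "Suc (i - j)"]
      by (intro DERIV_cmult DERIV_cdivide) (simp add: mult.commute)
    also have "of_nat (Suc (i - j)) * x ^ (i - j) / fact (Suc (i - j)) = x ^ (i - j) / fact (i - j)"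
      unfolding fact_Suc by (simp del: of_nat_Suc)
    finally show ?thesis unfolding e .
  qed
  moreover have "bern_pol (Suc i) = (\<lambda>x. (\<Sum>j\<le>i. bernoulli j / fact j * (x ^ (Suc i - j) / fact (Suc i - j)))
       + bernoulli (Suc i) / fact (Suc i))"
    by (auto simp: bern_pol_def fun_eq_iff)
  ultimately show ?thesis
    unfolding bern_pol_def [of i]
    by (simp only:) (rule DERIV_add [OF DERIV_sum DERIV_const, THEN DERIV_cong], auto)
qed

text \<open>The factor \<open>s - 1\<close>, absorbed into \<open>pochhammer (s - 1) i\<close>, makes the error term entire in \<open>s\<close>.\<close>

definition em_term :: "nat \<Rightarrow> complex \<Rightarrow> nat \<Rightarrow> complex" where
  "em_term M s n = (s - 1) * of_nat n powr (-s) -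
     (\<Sum>i<M. bern_coeff i * pochhammer (s - 1) i *
        (of_nat n powr (1 - s - of_nat i) - of_nat (Suc n) powr (1 - s - of_nat i)))"

lemma em_term_Suc:
  "em_term (Suc M) s n = em_term M s n - bern_coeff M * pochhammer (s - 1) M *
        (of_nat n powr (1 - s - of_nat M) - of_nat (Suc n) powr (1 - s - of_nat M))"
  by (simp add: em_term_def)

text \<open>With \<open>F z = z powr (-a)\<close> the sum is \<open>\<Sum>i\<le>N. (-1) ^ i * bern_pol i (z - c) * F\<^sup>(\<^sup>i\<^sup>) z\<close>, whose derivative
  telescopes because \<open>bern_pol i\<close> is the derivative of \<open>bern_pol (i + 1)\<close>.\<close>

lemma em_telescope_derivative:
  assumes z: "z \<notin> \<real>\<^sub>\<le>\<^sub>0"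
  shows "((\<lambda>z. \<Sum>i<Suc N. bern_pol i (z - c) * (pochhammer a i * z powr (-a - of_nat i)))
           has_field_derivative - (bern_pol N (z - c) * (pochhammer a (Suc N) * z powr (-a - of_nat (Suc N))))) (at z)"
proof (induction N)
  case 0
  show ?case using z
    by (auto intro!: derivative_eq_intros simp: algebra_simps)
next
  case (Suc N)
  have "((\<lambda>z. bern_pol (Suc N) (z - c)) has_field_derivative bern_pol N (z - c)) (at z)"
    by (rule DERIV_chain2[where g="\<lambda>z. z - c", OF has_field_derivative_bern_pol_Suc, THEN DERIV_cong])
       (auto intro!: derivative_eq_intros)
  moreover have "((\<lambda>z. pochhammer a (Suc N) * z powr (-a - of_nat (Suc N))) has_field_derivative
       - (pochhammer a (Suc (Suc N)) * z powr (-a - of_nat (Suc (Suc N))))) (at z)"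
    using z by (auto intro!: derivative_eq_intros simp: pochhammer_rec' [of a "Suc N"] algebra_simps)
  ultimately have "((\<lambda>z. bern_pol (Suc N) (z - c) * (pochhammer a (Suc N) * z powr (-a - of_nat (Suc N))))
     has_field_derivative 
      (bern_pol N (z - c) * (pochhammer a (Suc N) * z powr (-a - of_nat (Suc N)))
       - bern_pol (Suc N) (z - c) * (pochhammer a (Suc (Suc N)) * z powr (-a - of_nat (Suc (Suc N)))))) (at z)"
    by (rule DERIV_mult [THEN DERIV_cong]) (simp add: algebra_simps)
  from DERIV_add [OF Suc this] show ?case
    by (simp only: sum.lessThan_Suc [of _ "Suc N"]) (simp only: add.left_inverse minus_add_distrib diff_conv_add_uminus add.assoc [symmetric] add_0_left add_0_right)
qed

text \<open>The error term is the increment over \<open>[n, n + 1]\<close> of the telescoping sum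
  differentiated above. That derivative is a single product containing
  \<open>pochhammer (s - 1) M\<close>, so the mean value inequality on a segment of length 1 gives
  the bound.\<close>

lemma em_term_bound:
  assumes M: "M \<ge> 2"
  obtains C where "C \<ge> 0"
    "\<And>s n. n > 0 \<Longrightarrow> Re s + of_nat M \<ge> 1 \<Longrightarrow>
       cmod (em_term M s n) \<le> C * cmod (pochhammer (s - 1) M) * of_nat n powr (1 - Re s - of_nat M)"
proof -
  from M obtain N where MN: "M = Suc (Suc N)"
    by (metis Suc_le_D Suc_le_mono numeral_2_eq_2)
  have "continuous_on (cball 0 1) (bern_pol (Suc N))"
    by (intro continuous_at_imp_continuous_on ballI) (rule DERIV_isCont, rule has_field_derivative_bern_pol_Suc)
  then have "bounded (bern_pol (Suc N) ` cball 0 1)"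
    by (intro compact_imp_bounded compact_continuous_image) auto
  then obtain C where C: "\<And>z. cmod z \<le> 1 \<Longrightarrow> cmod (bern_pol (Suc N) z) \<le> C"
    by (metis bounded_iff dist_0_norm imageI mem_cball)
  have C0: "C \<ge> 0" using C[of 0] order_trans[OF norm_ge_zero] by auto
  show ?thesis
  proof (rule that[of C])
    show "C \<ge> 0" by fact
    fix s :: complex and n :: nat
    assume n: "n > 0" and s: "Re s + of_nat M \<ge> 1"
    define a where "a = s - 1"
    define S where "S = closed_segment (of_nat n :: complex) (of_nat (Suc n))"
    define \<Phi> where "\<Phi> = (\<lambda>z. \<Sum>i<M. bern_pol i (z - of_nat n) * (pochhammer a i * z powr (-a - of_nat i)))"
    define \<Phi>' where "\<Phi>' = (\<lambda>z. - (bern_pol (Suc N) (z - of_nat n) * (pochhammer a M * z powr (-a - of_nat M))))"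
    have S: "\<exists>x. z = of_real x \<and> real n \<le> x \<and> x \<le> real n + 1" if "z \<in> S" for z
    proof -
      from that obtain u where u: "0 \<le> u" "u \<le> 1" "z = (1 - u) *\<^sub>R of_nat n + u *\<^sub>R of_nat (Suc n)"
        by (auto simp: S_def in_segment)
      then have "z = of_real (real n + u)"
        by (simp add: scaleR_conv_of_real algebra_simps)
      with u show ?thesis by (intro exI [of _ "real n + u"]) simp
    qed
    have der: "(\<Phi> has_field_derivative \<Phi>' z) (at z within S)" if "z \<in> S" for z
    proof -
      have "z \<notin> \<real>\<^sub>\<le>\<^sub>0" using S[OF that] n by (auto simp: complex_nonpos_Reals_iff)
      from em_telescope_derivative [OF this, where N = "Suc N" and c = "of_nat n" and a = a]
      show ?thesis unfolding \<Phi>_def \<Phi>'_def MN by (rule has_field_derivative_at_within)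
    qed
    have bnd: "cmod (\<Phi>' z) \<le> C * cmod (pochhammer a M) * of_nat n powr (1 - Re s - of_nat M)"
      if "z \<in> S" for z
    proof -
      from S[OF that] obtain x where x: "z = of_real x" "real n \<le> x" "x \<le> real n + 1" by auto
      have "cmod (z powr (-a - of_nat M)) = x powr (1 - Re s - of_nat M)"
        using x n by (subst norm_powr_real_powr) (auto simp: a_def)
      also have "\<dots> \<le> of_nat n powr (1 - Re s - of_nat M)"
        using x n s by (intro powr_mono2') auto
      finally have p: "cmod (z powr (-a - of_nat M)) \<le> of_nat n powr (1 - Re s - of_nat M)" .
      have "z - of_nat n = of_real (x - real n)" using x by simp
      then have "cmod (z - of_nat n) \<le> 1"
        using x by (simp only: norm_of_real)
      then have "cmod (bern_pol (Suc N) (z - of_nat n)) \<le> C" by (rule C)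
      then have "cmod (bern_pol (Suc N) (z - of_nat n)) * (cmod (pochhammer a M) * cmod (z powr (-a - of_nat M)))
          \<le> C * (cmod (pochhammer a M) * of_nat n powr (1 - Re s - of_nat M))"
        using p C0 by (intro mult_mono) auto
      then show ?thesis by (simp add: \<Phi>'_def norm_mult mult.assoc)
    qed
    have "cmod (\<Phi> (of_nat (Suc n)) - \<Phi> (of_nat n)) \<le>
       (C * cmod (pochhammer a M) * of_nat n powr (1 - Re s - of_nat M)) * cmod (of_nat (Suc n) - of_nat n)"
      by (rule field_differentiable_bound[of S, OF _ der bnd]) (auto simp: S_def)
    \<comment> \<open>The endpoint values of \<open>bern_pol i\<close> are
      \<open>bern_coeff i\<close> on the right and \<open>bernoulli i / i!\<close> on the left. They
      differ only at \<open>i = 1\<close>, and this difference produces the term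
      \<open>(s - 1) * n powr (-s)\<close>.\<close>
    moreover have "em_term M s n = \<Phi> (of_nat (Suc n)) - \<Phi> (of_nat n)"
    proof -
      have e1: "\<Phi> (of_nat (Suc n)) = (\<Sum>i<M. bern_coeff i * pochhammer a i * of_nat (Suc n) powr (1 - s - of_nat i))"
        by (auto simp: \<Phi>_def a_def bern_pol_1 mult.assoc intro!: sum.cong)
      have "\<Phi> (of_nat n) = (\<Sum>i<M. (bern_coeff i - (if i = 1 then 1 else 0)) * pochhammer a i * of_nat n powr (1 - s - of_nat i))"
        by (auto simp: \<Phi>_def a_def bern_pol_0 bern_coeff_eq mult.assoc intro!: sum.cong)
      also have "\<dots> = (\<Sum>i<M. bern_coeff i * pochhammer a i * of_nat n powr (1 - s - of_nat i)) -
              (\<Sum>i<M. if i = 1 then pochhammer a i * of_nat n powr (1 - s - of_nat i) else 0)"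
        unfolding sum_subtractf [symmetric] by (rule sum.cong) (auto simp: algebra_simps)
      also have "(\<Sum>i<M. if i = 1 then pochhammer a i * of_nat n powr (1 - s - of_nat i) else 0) = a * of_nat n powr (-s)"
        using M by (subst sum.delta) auto
      finally show ?thesis
        unfolding e1 em_term_def a_def [symmetric]
        by (simp add: right_diff_distrib sum_subtractf)
    qed
    ultimately show "cmod (em_term M s n) \<le> C * cmod (pochhammer (s - 1) M) * of_nat n powr (1 - Re s - of_nat M)"
      by (simp add: a_def)
  qed
qed

section \<open>Continuation of Dirichlet series by parts\<close>

lemma em_term_holomorphic: "(\<lambda>s. em_term M s (Suc n)) holomorphic_on A"
  unfolding em_term_def pochhammer_prod by (intro holomorphic_intros)

text \<open>The linear bound costs one power of \<open>n\<close> in the error series, hence the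
  half-plane \<open>Re s > 3 - M\<close>. The growth condition removes the boundary term of the
  summation by parts, and analyticity of \<open>D\<close> for \<open>Re s > 0\<close> excludes
  singularities of the continuation for \<open>Re s > 1\<close>.\<close>

locale dirichlet_series_by_parts =
  fixes a :: "nat \<Rightarrow> complex" and D :: "complex \<Rightarrow> complex"
  assumes a_0: "a 0 = 0"
    and a_le: "cmod (a n) \<le> real n"
    and a_growth: "\<epsilon> > 0 \<Longrightarrow> (\<lambda>n. cmod (a n) * real n powr (-\<epsilon>)) \<longlonglongrightarrow> 0"
    and D_sums: "Re s > 0 \<Longrightarrow> (\<lambda>n. (a (Suc n) - a n) * of_nat (Suc n) powr (-s)) sums D s"
    and D_meromorphic: "D meromorphic_on UNIV"
    and D_analytic: "Re s > 0 \<Longrightarrow> D analytic_on {s}"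
begin

text \<open>Abel summation; the only boundary term is \<open>a N * (N + 1) powr (-s)\<close>, which
  tends to 0 by \<open>a_growth\<close>.\<close>

lemma sums_by_parts:
  assumes s: "Re s > 0"
  shows "(\<lambda>n. a (Suc n) * (of_nat (Suc n) powr (-s) - of_nat (Suc (Suc n)) powr (-s))) sums D s"
proof -
  define x :: "nat \<Rightarrow> complex" where "x n = of_nat n powr (-s)" for n
  have "(\<Sum>n<N. a (Suc n) * (x (Suc n) - x (Suc (Suc n)))) =
      (\<Sum>n<N. (a (Suc n) - a n) * x (Suc n)) - a N * x (Suc N)" for N
    by (induction N) (simp_all add: a_0 algebra_simps)
  moreover have "(\<lambda>N. (\<Sum>n<N. (a (Suc n) - a n) * x (Suc n)) - a N * x (Suc N)) \<longlonglongrightarrow> D s - 0"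
  proof (rule tendsto_diff)
    show "(\<lambda>N. \<Sum>n<N. (a (Suc n) - a n) * x (Suc n)) \<longlonglongrightarrow> D s"
      using D_sums [OF s] by (simp add: sums_def x_def)
    show "(\<lambda>N. a N * x (Suc N)) \<longlonglongrightarrow> 0"
    proof (rule Lim_null_comparison [OF _ a_growth [OF s]])
      show "\<forall>\<^sub>F N in sequentially. cmod (a N * x (Suc N)) \<le> cmod (a N) * real N powr (- Re s)"
        using eventually_gt_at_top [of 0]
      proof eventually_elim
        case (elim N)
        have "cmod (x (Suc N)) = real (Suc N) powr (- Re s)"
          unfolding x_def by (subst norm_powr_real_powr) auto
        also have "\<dots> \<le> real N powr (- Re s)"
          using elim s by (intro powr_mono2') auto
        finally show ?case
          by (simp add: norm_mult mult_left_mono)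
      qed
    qed
  qed
  ultimately show ?thesis
    by (simp add: sums_def x_def)
qed

definition em_sum :: "nat \<Rightarrow> complex \<Rightarrow> complex" where
  "em_sum M s = (\<Sum>n. a (Suc n) * em_term M s (Suc n))"

text \<open>Locally uniform convergence by comparison with a convergent power series of exponents
  below -1. The derivative is recorded as a sum of termwise derivatives, in order to be evaluated at
  \<open>s = 1\<close> for zeta.\<close>

lemma em_sum_sums_and_derivative:
  assumes M: "M \<ge> 2" and s: "Re s + of_nat M > 3"
  shows "(\<lambda>n. a (Suc n) * em_term M s (Suc n)) sums em_sum M s"
    and "\<exists>d. (\<lambda>n. a (Suc n) * deriv (\<lambda>s. em_term M s (Suc n)) s) sums d \<and>
           (em_sum M has_field_derivative d) (at s)"
proof -
  define H where "H = {s. Re s > 3 - real M}"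
  have "open H" unfolding H_def by (rule open_halfspace_Re_gt)
  obtain C where C: "C \<ge> 0" "\<And>s n. n > 0 \<Longrightarrow> Re s + of_nat M \<ge> 1 \<Longrightarrow>
       cmod (em_term M s n) \<le> C * cmod (pochhammer (s - 1) M) * of_nat n powr (1 - Re s - of_nat M)"
    using em_term_bound [OF M] by blast
  have "\<exists>d h. 0 < d \<and> summable h \<and> range h \<subseteq> \<real>\<^sub>\<ge>\<^sub>0 \<and>
      (\<forall>\<^sub>F n in sequentially. \<forall>y\<in>ball x d \<inter> H. cmod (a (Suc n) * em_term M y (Suc n)) \<le> cmod (h n))"
    if x: "x \<in> H" for x
  proof -
    \<comment> \<open>Half the distance from \<open>Re x\<close> to the boundary of the half-plane:
      on \<open>ball x d\<close> one has \<open>Re y + M - 3 > d\<close>, so after the factor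
      \<open>Suc n\<close> from \<open>a_le\<close> the exponent is still at most
      \<open>-1 - d\<close>.\<close>
    define d where "d = (Re x + real M - 3) / 2"
    have d: "d > 0" using x by (simp add: d_def H_def)
    have "continuous_on (cball x d) (\<lambda>y. pochhammer (y - 1) M)"
      unfolding pochhammer_prod by (intro continuous_intros)
    then have "bounded ((\<lambda>y. pochhammer (y - 1) M) ` cball x d)"
      by (intro compact_imp_bounded compact_continuous_image) auto
    then obtain K where K: "\<And>y. y \<in> cball x d \<Longrightarrow> cmod (pochhammer (y - 1) M) \<le> K"
      by (metis bounded_iff imageI)
    have K0: "K \<ge> 0" using K [of x] d order_trans [OF norm_ge_zero] by auto
    define h where "h n = C * K * real (Suc n) powr (-1 - d)" for n
    have h: "h n \<ge> 0" for n using C(1) K0 by (simp add: h_def)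
    have "summable h"
      unfolding h_def using d
      by (intro summable_mult) (subst summable_Suc_iff [of "\<lambda>n. real n powr (-1 - d)"], simp add: summable_real_powr_iff)
    moreover have "cmod (a (Suc n) * em_term M y (Suc n)) \<le> h n" if y: "y \<in> ball x d" for y n
    proof -
      have "\<bar>Re (x - y)\<bar> < d"
        using y abs_Re_le_cmod [of "x - y"] by (simp add: dist_norm)
      moreover have "2 * d = Re x + real M - 3" by (simp add: d_def)
      ultimately have yd: "Re y + real M - 3 > d" by simp
      have "cmod (em_term M y (Suc n)) \<le> C * cmod (pochhammer (y - 1) M) * of_nat (Suc n) powr (1 - Re y - of_nat M)"
        using yd d by (intro C) auto
      also have "\<dots> \<le> C * K * real (Suc n) powr (-2 - d)"
        using yd C(1) K K0 y by (intro mult_mono powr_mono mult_left_mono mult_nonneg_nonneg) auto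
      finally have "cmod (a (Suc n)) * cmod (em_term M y (Suc n)) \<le> real (Suc n) * (C * K * real (Suc n) powr (-2 - d))"
        by (intro mult_mono a_le) auto
      also have "\<dots> = C * K * (real (Suc n) powr 1 * real (Suc n) powr (-2 - d))"
        by simp
      also have "\<dots> = h n"
        unfolding powr_add [symmetric] h_def by simp
      finally show ?thesis by (simp add: norm_mult)
    qed
    ultimately show ?thesis
      using d h
      by (intro exI [of _ d] exI [of _ "\<lambda>n. complex_of_real (h n)"])
         (auto simp: summable_of_real image_subset_iff)
  qed
  moreover have "((\<lambda>s. a (Suc n) * em_term M s (Suc n)) has_field_derivative
       a (Suc n) * deriv (\<lambda>s. em_term M s (Suc n)) x) (at x)" for n x
    by (intro DERIV_cmult holomorphic_derivI [OF em_term_holomorphic, of UNIV]) auto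
  ultimately obtain g g' where g: "\<And>x. x \<in> H \<Longrightarrow> (\<lambda>n. a (Suc n) * em_term M x (Suc n)) sums g x"
     "\<And>x. x \<in> H \<Longrightarrow> (\<lambda>n. a (Suc n) * deriv (\<lambda>s. em_term M s (Suc n)) x) sums g' x"
     "\<And>x. x \<in> H \<Longrightarrow> (g has_field_derivative g' x) (at x)"
    using series_and_derivative_comparison_complex
        [OF \<open>open H\<close>, of "\<lambda>n s. a (Suc n) * em_term M s (Suc n)" "\<lambda>n x. a (Suc n) * deriv (\<lambda>s. em_term M s (Suc n)) x"]
    by blast
  have gS: "g x = em_sum M x" if "x \<in> H" for x
    using g(1) [OF that] by (simp add: em_sum_def sums_iff)
  have sH: "s \<in> H" using s by (simp add: H_def)
  show "(\<lambda>n. a (Suc n) * em_term M s (Suc n)) sums em_sum M s"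
    using g(1) [OF sH] gS [OF sH] by simp
  have "(em_sum M has_field_derivative g' s) (at s)"
    by (rule has_field_derivative_transform_within_open [OF g(3) [OF sH] \<open>open H\<close> sH gS])
  with g(2) [OF sH] show "\<exists>d. (\<lambda>n. a (Suc n) * deriv (\<lambda>s. em_term M s (Suc n)) s) sums d \<and>
           (em_sum M has_field_derivative d) (at s)"
    by blast
qed

lemma em_sum_analytic:
  assumes M: "M \<ge> 2" and s: "Re s + of_nat M > 3"
  shows "em_sum M analytic_on {s}"
proof -
  have "em_sum M holomorphic_on {s. Re s > 3 - real M}"
  proof (rule holomorphic_onI, rule field_differentiable_at_within)
    fix s assume "s \<in> {s. Re s > 3 - real M}"
    then show "em_sum M field_differentiable at s"
      using em_sum_sums_and_derivative(2) [OF M, of s] by (auto simp: field_differentiable_def)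
  qed
  then have "em_sum M analytic_on {s. Re s > 3 - real M}"
    by (simp add: analytic_on_open open_halfspace_Re_gt)
  then show ?thesis
    by (rule analytic_on_subset) (use s in auto)
qed

text \<open>For \<open>Re s > 1\<close> this is \<open>s - 1\<close> times the original Dirichlet
  series.\<close>

definition em_numer :: "nat \<Rightarrow> complex \<Rightarrow> complex" where
  "em_numer M s = (\<Sum>i<M. bern_coeff i * pochhammer (s - 1) i * D (s + of_nat i - 1)) + em_sum M s"

lemma sums_by_parts_shift:
  assumes "Re s + of_nat i > 1"
  shows "(\<lambda>n. a (Suc n) * (of_nat (Suc n) powr (1 - s - of_nat i) - of_nat (Suc (Suc n)) powr (1 - s - of_nat i)))
          sums D (s + of_nat i - 1)"
  using sums_by_parts [of "s + of_nat i - 1"] assms by (simp add: algebra_simps)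

text \<open>The summand of index \<open>M\<close> gained by the finite sum is exactly what
  \<open>em_term_Suc\<close> takes away from the error series, by summation by parts at
  \<open>s + M - 1\<close>.\<close>

lemma em_numer_Suc:
  assumes M: "M \<ge> 2" and s: "Re s + of_nat M > 3"
  shows "em_numer (Suc M) s = em_numer M s"
proof -
  have "(\<lambda>n. a (Suc n) * em_term M s (Suc n) - (bern_coeff M * pochhammer (s - 1) M) *
        (a (Suc n) * (of_nat (Suc n) powr (1 - s - of_nat M) - of_nat (Suc (Suc n)) powr (1 - s - of_nat M)))) sums
      (em_sum M s - (bern_coeff M * pochhammer (s - 1) M) * D (s + of_nat M - 1))"
    using s by (intro sums_diff sums_mult em_sum_sums_and_derivative(1) [OF M s] sums_by_parts_shift) auto
  then have "(\<lambda>n. a (Suc n) * em_term (Suc M) s (Suc n)) sums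
      (em_sum M s - (bern_coeff M * pochhammer (s - 1) M) * D (s + of_nat M - 1))"
    by (simp add: em_term_Suc algebra_simps)
  then have "em_sum (Suc M) s = em_sum M s - (bern_coeff M * pochhammer (s - 1) M) * D (s + of_nat M - 1)"
    by (simp add: em_sum_def sums_iff)
  then show ?thesis
    by (simp add: em_numer_def)
qed

lemma em_numer_eq:
  assumes "M \<ge> 2" "Re s + of_nat M > 3" "N \<ge> M"
  shows "em_numer N s = em_numer M s"
  using assms(3,1,2) by (induction rule: dec_induct) (auto simp: em_numer_Suc)

text \<open>All pieces converge for \<open>Re s > 1\<close>; adding them termwise cancels the finite
  sum inside \<open>em_term\<close> and leaves \<open>(s - 1) * a n * n powr (-s)\<close>.\<close>

lemma dirichlet_sums_em_numer:
  assumes M: "M \<ge> 2" and s: "Re s > 1"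
  shows "(\<lambda>n. a (Suc n) * of_nat (Suc n) powr (-s)) sums (em_numer M s / (s - 1))"
proof -
  have "s \<noteq> 1" using s by auto
  have "(\<lambda>n. (\<Sum>i<M. (bern_coeff i * pochhammer (s - 1) i) *
        (a (Suc n) * (of_nat (Suc n) powr (1 - s - of_nat i) - of_nat (Suc (Suc n)) powr (1 - s - of_nat i))))
         + a (Suc n) * em_term M s (Suc n)) sums em_numer M s"
    unfolding em_numer_def using s M
    by (intro sums_add sums_sum sums_mult em_sum_sums_and_derivative(1) [OF M] sums_by_parts_shift) auto
  then have "(\<lambda>n. (s - 1) * (a (Suc n) * of_nat (Suc n) powr (-s))) sums em_numer M s"
    by (simp add: em_term_def algebra_simps sum_distrib_left sum_subtractf)
  from sums_divide [OF this, of "s - 1"] show ?thesis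
    using \<open>s \<noteq> 1\<close> by simp
qed

text \<open>Any order \<open>M \<ge> 2\<close> with \<open>Re s + M > 3\<close> gives the same value; the one below is such a choice.\<close>

definition continuation :: "complex \<Rightarrow> complex" where
  "continuation s = em_numer (nat \<lceil>5 - Re s\<rceil> + 2) s / (s - 1)"

lemma continuation_eq:
  assumes "M \<ge> 2" "Re s + of_nat M > 3"
  shows "continuation s = em_numer M s / (s - 1)"
proof -
  define N where "N = nat \<lceil>5 - Re s\<rceil> + 2"
  have "Re s + real N > 3" unfolding N_def by linarith
  have "em_numer N s = em_numer M s"
  proof (cases "M \<le> N")
    case True then show ?thesis using em_numer_eq assms by blast
  next
    case False then show ?thesis using em_numer_eq [of N s M] \<open>Re s + real N > 3\<close> by (simp add: N_def)
  qed
  then show ?thesis by (simp add: continuation_def N_def)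
qed

section \<open>Meromorphy and uniqueness of the continuation\<close>

lemma eventually_continuation_eq:
  assumes M: "M \<ge> 2" and s: "Re s + of_nat M > 3"
  shows "eventually (\<lambda>s. continuation s = em_numer M s / (s - 1)) (nhds s)"
proof -
  have "eventually (\<lambda>s. s \<in> {s. Re s > 3 - real M}) (nhds s)"
    using s by (intro eventually_nhds_in_open open_halfspace_Re_gt) auto
  then show ?thesis
    by eventually_elim (use M in \<open>auto intro!: continuation_eq\<close>)
qed

lemma ex_em_order: "\<exists>M\<ge>2. Re s + of_nat M > 3"
proof -
  have "Re s + real (nat \<lceil>5 - Re s\<rceil> + 2) > 3" by linarith
  then show ?thesis by (intro exI [of _ "nat \<lceil>5 - Re s\<rceil> + 2"]) auto
qed

lemma continuation_meromorphic: "continuation meromorphic_on UNIV"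
proof (subst meromorphic_on_meromorphic_at, rule ballI)
  fix s :: complex
  from ex_em_order obtain M where M: "M \<ge> 2" "Re s + of_nat M > 3" by blast
  have "(\<lambda>s. D (s + of_nat i - 1)) meromorphic_on {s}" for i
    by (rule meromorphic_on_compose [OF D_meromorphic]) (auto intro!: analytic_intros)
  moreover have "em_sum M meromorphic_on {s}"
    by (intro analytic_on_imp_meromorphic_on em_sum_analytic M)
  ultimately have "(\<lambda>s. em_numer M s / (s - 1)) meromorphic_on {s}"
    unfolding em_numer_def pochhammer_prod by (intro meromorphic_intros)
  moreover have "eventually (\<lambda>s. continuation s = em_numer M s / (s - 1)) (at s)"
    using eventually_continuation_eq [OF M] by (simp add: eventually_nhds_conv_at)
  ultimately show "continuation meromorphic_on {s}"
    using meromorphic_on_cong [of "{s}" continuation "\<lambda>s. em_numer M s / (s - 1)" "{s}"] by simp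
qed

lemma continuation_analytic:
  assumes M: "M \<ge> 2" "Re s + of_nat M > 3" and s: "s \<noteq> 1"
    and D: "\<And>i. i < M \<Longrightarrow> D analytic_on {s + of_nat i - 1}"
  shows "continuation analytic_on {s}"
proof -
  have "(\<lambda>s. D (s + of_nat i - 1)) analytic_on {s}" if "i < M" for i
  proof -
    have "(\<lambda>s. s + of_nat i - 1) analytic_on {s}" by (intro analytic_intros)
    from analytic_on_compose [OF this, of D] D [OF that] show ?thesis by (simp add: o_def)
  qed
  moreover have "em_sum M analytic_on {s}"
    by (intro em_sum_analytic M)
  ultimately have "(\<lambda>s. em_numer M s / (s - 1)) analytic_on {s}"
    using s unfolding em_numer_def pochhammer_prod by (intro analytic_intros) auto
  then show ?thesis
    using analytic_at_cong [OF eventually_continuation_eq [OF M] refl] by simp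
qed

text \<open>\<open>remove_sings\<close> supplies the normalised values that make the continuation
  unique. Agreement of \<open>c\<close> and \<open>a\<close> is asked at positive indices only, so
  that the constant weight 1 is covered although \<open>a 0 = 0\<close>.\<close>

lemma the_continuation:
  assumes c: "\<And>n. c (Suc n) = a (Suc n)"
  shows "(THE f. meromorphic_continuation_of_dirichlet_series f c) = remove_sings continuation"
proof (rule the_equality)
  show cont: "meromorphic_continuation_of_dirichlet_series (remove_sings continuation) c"
    unfolding meromorphic_continuation_of_dirichlet_series_def
  proof (intro conjI allI impI)
    show "remove_sings continuation nicely_meromorphic_on UNIV"
      by (intro remove_sings_nicely_meromorphic continuation_meromorphic)
    fix s :: complex assume s: "1 < Re s"
    \<comment> \<open>At order 2 only \<open>D (s - 1)\<close> and \<open>D s\<close> occur, both at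
      arguments with positive real part.\<close>
    have "continuation analytic_on {s}"
      using s by (intro continuation_analytic [of 2] D_analytic) auto
    then have "remove_sings continuation s = continuation s" by simp
    also have "\<dots> = em_numer 2 s / (s - 1)"
      using s by (intro continuation_eq) auto
    finally show "(\<lambda>n. c (Suc n) * of_nat (Suc n) powr - s) sums remove_sings continuation s"
      using dirichlet_sums_em_numer [of 2 s] s by (simp add: c)
  qed
  show "f = remove_sings continuation" if "meromorphic_continuation_of_dirichlet_series f c" for f
    using meromorphic_continuation_of_dirichlet_series_unique that cont by blast
qed

end

section \<open>The Riemann zeta function\<close>

text \<open>The bound carries the factor \<open>pochhammer (s - 1) M\<close>; this lets values at
  integers \<open>s \<le> 1\<close> be computed from finite sums alone.\<close>

lemma em_term_eq_0:
  assumes "M \<ge> 2" "Re s + of_nat M \<ge> 1" "pochhammer (s - 1) M = 0"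
  shows "em_term M s (Suc n) = 0"
proof -
  obtain C where "C \<ge> 0" "\<And>s n. n > 0 \<Longrightarrow> Re s + of_nat M \<ge> 1 \<Longrightarrow>
       cmod (em_term M s n) \<le> C * cmod (pochhammer (s - 1) M) * of_nat n powr (1 - Re s - of_nat M)"
    using em_term_bound [OF assms(1)] by blast
  from this(2) [of "Suc n" s] show ?thesis
    using assms by simp
qed

lemma (in dirichlet_series_by_parts) em_sum_eq_0:
  assumes "M \<ge> 2" "Re s + of_nat M \<ge> 1" "pochhammer (s - 1) M = 0"
  shows "em_sum M s = 0"
  by (simp add: em_sum_def em_term_eq_0 [OF assms])

lemma (in dirichlet_series_by_parts) eventually_remove_sings_continuation_eq:
  assumes "M \<ge> 2" "Re s + of_nat M > 3"
  shows "eventually (\<lambda>s. remove_sings continuation s = em_numer M s / (s - 1)) (at s)"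
proof -
  have "eventually (\<lambda>s. remove_sings continuation s = continuation s) (at s)"
    using continuation_meromorphic meromorphic_on_isolated_singularity meromorphic_on_subset
    by (intro eventually_remove_sings_eq_at) blast
  moreover have "eventually (\<lambda>s. continuation s = em_numer M s / (s - 1)) (at s)"
    using eventually_continuation_eq [OF assms] by (simp add: eventually_nhds_conv_at)
  ultimately show ?thesis
    by eventually_elim simp
qed

text \<open>Setting the weight of index 0 to 0 makes the differences \<open>1, 0, 0, ...\<close>,
  whose Dirichlet series is the constant 1.\<close>

interpretation zeta_em: dirichlet_series_by_parts "\<lambda>n. if n = 0 then 0 else 1" "\<lambda>s. 1"
proof
  show "(\<lambda>n. cmod (if n = 0 then 0 else 1) * real n powr (-\<epsilon>)) \<longlonglongrightarrow> 0" if "\<epsilon> > 0" for \<epsilon>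
  proof (rule Lim_null_comparison)
    show "(\<lambda>n. real n powr (-\<epsilon>)) \<longlonglongrightarrow> 0"
      using that by (intro tendsto_neg_powr filterlim_real_sequentially) auto
  qed auto
  show "(\<lambda>n. ((if Suc n = 0 then 0 else 1) - (if n = 0 then 0 else 1)) * of_nat (Suc n) powr (-s)) sums 1"
    for s :: complex
    using sums_single [of 0 "\<lambda>_. 1 :: complex"] by (rule sums_cong [THEN iffD1, rotated]) auto
qed auto

lemma zeta_conv_remove_sings: "zeta = remove_sings zeta_em.continuation"
  unfolding zeta_def by (rule zeta_em.the_continuation) auto

lemma zeta_analytic: "zeta analytic_on {s}" if "s \<noteq> 1"
proof -
  obtain M where "M \<ge> 2" "Re s + of_nat M > 3" using zeta_em.ex_em_order by blast
  then have "zeta_em.continuation analytic_on {s}"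
    using that by (intro zeta_em.continuation_analytic) auto
  then show ?thesis
    unfolding zeta_conv_remove_sings by (rule remove_sings_analytic_on)
qed

lemma zeta_eq_em_numer:
  assumes "s \<noteq> 1" "M \<ge> 2" "Re s + of_nat M > 3"
  shows "zeta s = zeta_em.em_numer M s / (s - 1)"
proof -
  have "zeta_em.continuation analytic_on {s}"
    using assms by (intro zeta_em.continuation_analytic) auto
  then show ?thesis
    unfolding zeta_conv_remove_sings using zeta_em.continuation_eq [OF assms(2,3)] by simp
qed

lemma zeta_meromorphic: "zeta meromorphic_on UNIV"
  unfolding zeta_conv_remove_sings
  by (intro remove_sings_meromorphic zeta_em.continuation_meromorphic)

lemma zeta_sums:
  assumes "Re s > 1"
  shows "(\<lambda>n. of_nat (Suc n) powr (-s)) sums zeta s"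
proof -
  have "zeta s = zeta_em.em_numer 2 s / (s - 1)"
    using assms by (intro zeta_eq_em_numer) auto
  with zeta_em.dirichlet_sums_em_numer [of 2 s] assms show ?thesis by simp
qed

section \<open>Values of zeta at nonpositive integers\<close>

lemma pochhammer_minus_of_nat:
  "i \<le> n \<Longrightarrow> pochhammer (- of_nat n) i = (-1) ^ i * fact n / (fact (n - i) :: complex)"
proof -
  assume "i \<le> n"
  have "(of_nat n gchoose i :: complex) = (-1) ^ i * pochhammer (- of_nat n) i / fact i"
    by (rule gbinomial_pochhammer)
  moreover have "(of_nat n gchoose i :: complex) = fact n / (fact i * fact (n - i))"
    using \<open>i \<le> n\<close> by (simp add: binomial_fact flip: binomial_gbinomial)
  ultimately have "(-1) ^ i * ((-1) ^ i * pochhammer (- of_nat n) i) = (-1) ^ i * (fact n / (fact (n - i) :: complex))"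
    by (simp add: field_simps)
  then show ?thesis
    by (simp add: flip: mult.assoc power_mult_distrib)
qed

text \<open>At \<open>s = -n\<close> the error vanishes and the Pochhammer symbols cut the sum at
  \<open>i = n + 1\<close>. Their signs turn \<open>bern_coeff i\<close> into
  \<open>bernoulli i / i!\<close>, so the sum is the convolution with the exponential
  series.\<close>

lemma zeta_minus_of_nat: "zeta (- of_nat n) = - fact n * bern_coeff (Suc n)"
proof -
  define M where "M = n + 4"
  have p: "pochhammer (- of_nat n - 1 :: complex) i = pochhammer (- of_nat (Suc n)) i" for i
  proof -
    have "- of_nat n - 1 = (- of_nat (Suc n) :: complex)" by simp
    then show ?thesis by (simp only:)
  qed
  have p0: "pochhammer (- of_nat n - 1 :: complex) i = 0" if "i > Suc n" for i
    unfolding p using that by (rule pochhammer_of_nat_eq_0_lemma)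
  have "zeta_em.em_numer M (- of_nat n) = (\<Sum>i<M. bern_coeff i * pochhammer (- of_nat n - 1) i)"
    unfolding zeta_em.em_numer_def
    by (subst zeta_em.em_sum_eq_0) (auto simp: M_def intro!: p0)
  also have "\<dots> = (\<Sum>i\<le>Suc n. bern_coeff i * pochhammer (- of_nat n - 1) i)"
    by (intro sum.mono_neutral_right) (auto simp: M_def intro!: p0)
  also have "\<dots> = (\<Sum>i\<le>Suc n. fact (Suc n) * (bernoulli i / fact i * (1 / fact (Suc n - i))))"
    unfolding p
    by (intro sum.cong refl, subst pochhammer_minus_of_nat)
       (auto simp: simp flip: bern_coeff_uminus)
  also have "\<dots> = fact (Suc n) * bern_coeff (Suc n)"
    unfolding sum_distrib_left [symmetric] bern_coeff_convolution ..
  finally have *: "zeta_em.em_numer M (- of_nat n) = fact (Suc n) * bern_coeff (Suc n)" .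
  have ne: "(- of_nat n - 1 :: complex) = - of_nat (Suc n)" "- of_nat n \<noteq> (1 :: complex)"
  proof -
    show "(- of_nat n - 1 :: complex) = - of_nat (Suc n)" by simp
    have "of_nat n + 1 \<noteq> (0 :: complex)"
      by (metis of_nat_Suc of_nat_neq_0 add.commute)
    then show "- of_nat n \<noteq> (1 :: complex)" by (metis add.right_inverse)
  qed
  have "zeta (- of_nat n) = fact (Suc n) * bern_coeff (Suc n) / (- of_nat (Suc n))"
    unfolding ne(1) [symmetric] * [symmetric]
    by (rule zeta_eq_em_numer) (auto simp: M_def ne)
  also have "\<dots> = - fact n * bern_coeff (Suc n)"
    unfolding fact_Suc by (simp del: of_nat_Suc)
  finally show ?thesis .
qed

section \<open>Residue and constant term of zeta at 1\<close>

lemma has_field_derivative_pochhammer_minus_1: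
  "((\<lambda>s. pochhammer (s - 1) i) has_field_derivative (if i = 0 then 0 else fact (i - 1))) (at (1::complex))"
proof (cases i)
  case (Suc j)
  \<comment> \<open>Once the simple zero at 1 is split off, the derivative there is the value of the
    cofactor, \<open>1 * 2 * ... * j = (i - 1)!\<close>.\<close>
  have eq: "pochhammer (s - 1) (Suc j) = (s - 1) * (\<Prod>k<j. s + of_nat k)" for s :: complex
    by (simp only: pochhammer_rec) (simp add: pochhammer_prod atLeast0LessThan)
  have "((\<lambda>s. \<Prod>k<j. s + of_nat k) has_field_derivative deriv (\<lambda>s::complex. \<Prod>k<j. s + of_nat k) 1) (at 1)"
    by (rule holomorphic_derivI [where S = UNIV]) (auto intro!: holomorphic_intros)
  then have "((\<lambda>s. (s - 1) * (\<Prod>k<j. s + of_nat k)) has_field_derivative (\<Prod>k<j. 1 + of_nat k)) (at (1::complex))"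
    by (auto intro!: derivative_eq_intros)
  then show ?thesis
    unfolding Suc eq by (simp add: pochhammer_fact pochhammer_prod atLeast0LessThan)
qed simp

text \<open>The residue of zeta at 1. Order 3 is the least \<open>M\<close> with
  \<open>1 + M > 3\<close>.\<close>

lemma zeta_em_numer_1: "zeta_em.em_numer 3 1 = 1"
proof -
  have "zeta_em.em_sum 3 1 = 0" by (rule zeta_em.em_sum_eq_0) (auto simp: pochhammer_0_left)
  moreover have "(\<Sum>i<3. bern_coeff i * pochhammer 0 i) = bern_coeff 0"
    by (subst sum.remove [of _ 0]) (auto simp: pochhammer_0_left)
  ultimately show ?thesis
    by (simp add: zeta_em.em_numer_def bern_coeff_simps)
qed

text \<open>For \<open>i > 0\<close> the Pochhammer factor vanishes at 1, so only its derivative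
  survives; for \<open>i = 0\<close> it is constant and the powers contribute logarithms.\<close>

lemma deriv_em_term_1:
  "deriv (\<lambda>s. em_term M s (Suc n)) 1 = inverse (of_nat (Suc n)) -
     (\<Sum>i<M. bern_coeff i * (if i = 0 then of_real (ln (real (n + 2))) - of_real (ln (real (n + 1)))
        else fact (i - 1) * (1 / of_nat (Suc n) ^ i - 1 / of_nat (Suc (Suc n)) ^ i)))"
proof (rule DERIV_imp_deriv)
  have Lns: "Ln (of_nat (Suc k)) = of_real (ln (real (Suc k)))" for k
    by (metis Ln_of_real of_nat_0_less_iff of_real_of_nat_eq zero_less_Suc)
  have powr: "((\<lambda>s. c powr (1 - s - b)) has_field_derivative - Ln c * c powr (1 - t - b)) (at t)"
    if "c \<noteq> 0" for b c t :: complex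
  proof -
    have "((\<lambda>s. 1 - s - b) has_field_derivative -1) (at t)"
      by (auto intro!: derivative_eq_intros)
    from DERIV_chain2 [OF has_field_derivative_powr_right [OF that] this] show ?thesis by simp
  qed
  have A: "((\<lambda>s. (s - 1) * of_nat (Suc n) powr (-s)) has_field_derivative inverse (of_nat (Suc n))) (at (1::complex))"
    using DERIV_mult [OF DERIV_diff [OF DERIV_ident DERIV_const] powr [of "of_nat (Suc n)" 1], of 1 1]
    by (simp add: powr_minus del: of_nat_Suc)
  have B: "((\<lambda>s. bern_coeff i * pochhammer (s - 1) i *
       (of_nat (Suc n) powr (1 - s - of_nat i) - of_nat (Suc (Suc n)) powr (1 - s - of_nat i)))
     has_field_derivative bern_coeff i * (if i = 0 then of_real (ln (real (n + 2))) - of_real (ln (real (n + 1)))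
        else fact (i - 1) * (1 / of_nat (Suc n) ^ i - 1 / of_nat (Suc (Suc n)) ^ i))) (at 1)" for i
  proof -
    have ne: "of_nat (Suc n) \<noteq> (0::complex)" "of_nat (Suc (Suc n)) \<noteq> (0::complex)"
      by (simp_all only: of_nat_eq_0_iff nat.distinct not_False_eq_True)
    note DERIV_cmult [OF DERIV_mult [OF has_field_derivative_pochhammer_minus_1 [of i]
      DERIV_diff [OF powr [OF ne(1)] powr [OF ne(2)]]], of "bern_coeff i" "of_nat i" "of_nat i"]
    then show ?thesis
      unfolding mult.assoc
      by (rule DERIV_cong)
         (simp add: pochhammer_0_left powr_minus powr_nat' divide_inverse Lns ne del: of_nat_Suc)
  qed
  show "((\<lambda>s. em_term M s (Suc n)) has_field_derivative inverse (of_nat (Suc n)) -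
     (\<Sum>i<M. bern_coeff i * (if i = 0 then of_real (ln (real (n + 2))) - of_real (ln (real (n + 1)))
        else fact (i - 1) * (1 / of_nat (Suc n) ^ i - 1 / of_nat (Suc (Suc n)) ^ i)))) (at 1)"
    unfolding em_term_def by (intro DERIV_diff A DERIV_sum B)
qed

text \<open>The constant term of zeta at 1. In the termwise derivatives the logarithmic part
  \<open>e\<close> sums to \<gamma>, while the parts \<open>q 1\<close> and \<open>q 2\<close>
  telescope and cancel the derivative of the finite sum.\<close>

lemma has_field_derivative_zeta_em_numer_1:
  "(zeta_em.em_numer 3 has_field_derivative euler_mascheroni) (at 1)"
proof -
  define q :: "nat \<Rightarrow> nat \<Rightarrow> complex"
    where "q i n = bern_coeff i * (fact (i - 1) * (1 / of_nat (Suc n) ^ i - 1 / of_nat (Suc (Suc n)) ^ i))" for i n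
  define e :: "nat \<Rightarrow> complex"
    where "e n = inverse (of_nat (n+1)) + of_real (ln (real (n+1))) - of_real (ln (real (n+2)))" for n
  obtain d where d: "(\<lambda>n. (if Suc n = 0 then 0 else 1) * deriv (\<lambda>s. em_term 3 s (Suc n)) 1) sums d"
     "(zeta_em.em_sum 3 has_field_derivative d) (at 1)"
    using zeta_em.em_sum_sums_and_derivative(2) [of 3 1] by auto
  have eq: "deriv (\<lambda>s. em_term 3 s (Suc n)) 1 = e n - (\<Sum>i\<in>{1,2}. q i n)" for n
  proof -
    have "{..<3::nat} = insert 0 {1,2}" by auto
    then show ?thesis
      unfolding deriv_em_term_1 by (simp add: e_def q_def bern_coeff_simps)
  qed
  have "q i sums (bern_coeff i * (fact (i - 1) * (1 - 0)))" if "i \<in> {1, 2}" for i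
  proof -
    have "(\<lambda>n. 1 / of_nat (Suc n) ^ i :: complex) \<longlonglongrightarrow> 0"
    proof -
      have "(\<lambda>n. (1 / of_nat (Suc n)) ^ i :: complex) \<longlonglongrightarrow> 0 ^ i"
        by (intro tendsto_power LIMSEQ_Suc lim_1_over_n)
      then show ?thesis using that by (auto simp: power_one_over)
    qed
    from telescope_sums' [OF this] show ?thesis
      unfolding q_def by (intro sums_mult) simp
  qed
  then have "(\<lambda>n. e n - (\<Sum>i\<in>{1,2}. q i n)) sums (euler_mascheroni - (\<Sum>i\<in>{1,2}. bern_coeff i * (fact (i - 1) * (1 - 0))))"
    unfolding e_def by (intro sums_diff sums_sum euler_mascheroni_sum)
  with d(1) have d_eq: "d = euler_mascheroni - (\<Sum>i\<in>{1,2}. bern_coeff i * fact (i - 1))"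
    unfolding eq by (auto dest: sums_unique2)
  have "((\<lambda>s. \<Sum>i<3. bern_coeff i * pochhammer (s - 1) i * 1) has_field_derivative
      (\<Sum>i<3. bern_coeff i * (if i = 0 then 0 else fact (i - 1)))) (at 1)"
    unfolding mult_1_right by (intro DERIV_sum DERIV_cmult has_field_derivative_pochhammer_minus_1)
  from DERIV_add [OF this d(2)]
  have "(zeta_em.em_numer 3 has_field_derivative (\<Sum>i<3. bern_coeff i * (if i = 0 then 0 else fact (i - 1))) + d) (at 1)"
    by (simp add: zeta_em.em_numer_def [abs_def])
  also have "(\<Sum>i<3. bern_coeff i * (if i = 0 then 0 else fact (i - 1))) + d = euler_mascheroni"
    by (simp add: d_eq numeral_3_eq_3 numeral_2_eq_2)
  finally show ?thesis .
qed

section \<open>The harmonic zeta function\<close>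

text \<open>Since \<open>H\<^sub>n - H\<^sub>n\<^sub>-\<^sub>1 = 1 / n\<close>, the differenced
  series is zeta shifted by 1. The growth condition follows from the convergence of
  \<open>H\<^sub>n - ln n\<close> and the slow growth of the logarithm.\<close>

interpretation harmonic_em: dirichlet_series_by_parts harm "\<lambda>s. zeta (s + 1)"
proof
  show "harm 0 = (0 :: complex)" by (simp add: harm_def)
  have norm_harm: "cmod (harm n) = harm n" for n
    using norm_of_real [of "harm n", where ?'a = complex] by (simp add: of_real_harm harm_nonneg)
  show "cmod (harm n) \<le> real n" for n
    unfolding norm_harm
  proof (induction n)
    case (Suc n)
    have "inverse (real (Suc n)) \<le> 1" by (simp add: field_simps)
    with Suc show ?case by (simp add: harm_Suc)
  qed (simp add: harm_def)
  show "(\<lambda>n. cmod (harm n) * real n powr (-\<epsilon>)) \<longlonglongrightarrow> 0" if "\<epsilon> > 0" for \<epsilon>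
  proof -
    have "(\<lambda>n. real n powr (-\<epsilon>)) \<longlonglongrightarrow> 0"
      using that by (intro tendsto_neg_powr filterlim_real_sequentially) auto
    moreover have "(\<lambda>n. ln (real n) * real n powr (-\<epsilon>)) \<longlonglongrightarrow> 0"
      using lim_ln_over_power [OF that] by (simp add: powr_minus divide_inverse)
    ultimately have "(\<lambda>n. (harm n - ln (real n)) * real n powr (-\<epsilon>) + ln (real n) * real n powr (-\<epsilon>)) 
        \<longlonglongrightarrow> euler_mascheroni * 0 + 0"
      by (intro tendsto_add tendsto_mult euler_mascheroni_LIMSEQ)
    then show ?thesis by (simp add: norm_harm algebra_simps)
  qed
  show "(\<lambda>n. (harm (Suc n) - harm n) * of_nat (Suc n) powr (-s)) sums zeta (s + 1)"
    if "Re s > 0" for s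
  proof -
    have "(harm (Suc n) - harm n) * of_nat (Suc n) powr (-s) = of_nat (Suc n) powr (-(s + 1))" for n
    proof -
      have "-(s + 1) = -s + -1" by simp
      then have "of_nat (Suc n) powr (-(s + 1)) = of_nat (Suc n) powr (-s) * (of_nat (Suc n) powr (-1) :: complex)"
        by (simp only: powr_add)
      then show ?thesis by (simp add: harm_Suc powr_minus [of _ 1] del: of_nat_Suc)
    qed
    then show ?thesis using zeta_sums [of "s + 1"] that by (simp only:) simp
  qed
  show "(\<lambda>s. zeta (s + 1)) meromorphic_on UNIV"
    by (rule meromorphic_on_compose [OF zeta_meromorphic]) (auto intro!: analytic_intros)
  show "(\<lambda>s. zeta (s + 1)) analytic_on {s}" if "Re s > 0" for s
  proof -
    have "(\<lambda>s. s + 1) analytic_on {s}" by (intro analytic_intros)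
    moreover have "zeta analytic_on (\<lambda>s. s + 1) ` {s}"
      using that by (auto intro!: zeta_analytic)
    ultimately show ?thesis
      using analytic_on_compose [of "\<lambda>s. s + 1" "{s}" zeta] by (simp add: o_def)
  qed
qed

section \<open>Laurent expansion of the harmonic zeta function\<close>

lemma harmonic_zeta_conv_remove_sings: "harmonic_zeta = remove_sings harmonic_em.continuation"
  unfolding harmonic_zeta_def by (rule harmonic_em.the_continuation) auto

text \<open>The difference quotient of \<open>T\<close> at \<open>s0\<close> extends holomorphically
  with value \<open>c\<close>, hence deviates from \<open>c\<close> by
  \<open>O(s - s0)\<close>.\<close>

lemma simple_pole_expansion_bigo:
  fixes f T :: "complex \<Rightarrow> complex"
  assumes f: "eventually (\<lambda>s. f s = T s / (s - s0)) (at s0)"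
    and T: "T analytic_on {s0}" "(T has_field_derivative c) (at s0)"
  shows "(\<lambda>s. f s - (T s0 / (s - s0) + c)) \<in> O[at s0](\<lambda>s. s - s0)"
proof -
  from T(1) obtain S where S: "open S" "s0 \<in> S" "T holomorphic_on S"
    by (auto simp: analytic_at)
  define G where "G = (\<lambda>z. if z = s0 then deriv T s0 else (T z - T s0) / (z - s0))"
  have "G holomorphic_on S"
    unfolding G_def by (rule pole_lemma_open [OF S(3,1)])
  then have "(G has_field_derivative deriv G s0) (at s0)"
    by (rule holomorphic_derivI [OF _ S(1,2)])
  then have "((\<lambda>z. (G z - G s0) / (z - s0)) \<longlongrightarrow> deriv G s0) (at s0)"
    by (simp add: has_field_derivative_iff)
  then have "(\<lambda>z. G z - G s0) \<in> O[at s0](\<lambda>z. z - s0)"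
    by (rule bigoI_tendsto) (simp add: eventually_at_filter)
  also have "?this \<longleftrightarrow> ?thesis"
  proof (rule landau_o.big.in_cong)
    have "G s0 = c" using T(2) by (simp add: G_def DERIV_imp_deriv)
    have "eventually (\<lambda>z. z \<noteq> s0) (at s0)" by (simp add: eventually_at_filter)
    then show "eventually (\<lambda>z. G z - G s0 = f z - (T s0 / (z - s0) + c)) (at s0)"
      using f by eventually_elim (use \<open>G s0 = c\<close> in \<open>auto simp: G_def diff_divide_distrib\<close>)
  qed
  finally show ?thesis .
qed

lemma has_field_derivative_pochhammer:
  assumes "\<And>i. i < n \<Longrightarrow> s + of_nat i \<noteq> 0"
  shows "((\<lambda>s. pochhammer s n) has_field_derivative
           pochhammer s n * (\<Sum>i<n. 1 / (s + of_nat i))) (at (s :: complex))"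
  using assms
proof (induction n)
  case (Suc n)
  have "((\<lambda>s. pochhammer s n * (s + of_nat n)) has_field_derivative
     pochhammer s n * (\<Sum>i<n. 1 / (s + of_nat i)) * (s + of_nat n) + 1 * pochhammer s n) (at s)"
    using Suc by (intro DERIV_mult Suc.IH) (auto intro!: derivative_eq_intros)
  then show ?case
    unfolding pochhammer_Suc
  proof (rule DERIV_cong)
    have "P * S * x + 1 * P = P * x * (S + 1 / x)" if "x \<noteq> 0" for P S x :: complex
      using that by (simp add: field_simps)
    from this [OF Suc.prems [of n]]
    show "pochhammer s n * (\<Sum>i<n. 1 / (s + of_nat i)) * (s + of_nat n) + 1 * pochhammer s n =
        pochhammer s n * (s + of_nat n) * (\<Sum>i<Suc n. 1 / (s + of_nat i))"
      by simp
  qed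
qed simp

text \<open>
  The convolution below differs from \<open>A_coeff (2 * m)\<close> only in the sign of the term \<open>i = 1\<close>, which matters
  for \<open>m = 1\<close> only since \<open>bern_coeff (2 * m - 1) = 0\<close> otherwise.
\<close>

lemma harmonic_zeta_expansion:
  fixes m :: nat
  assumes m: "m \<ge> 1"
  defines "s0 \<equiv> 1 - 2 * of_nat m"
  shows "(\<lambda>s. harmonic_zeta s -
           (zeta s0 / (s - s0) +
            (fact (2 * m - 1) * (\<Sum>i<2*m. bernoulli i / fact i * (bern_coeff (2 * m - i) / of_nat (2 * m - i)))
             - Digamma (2 * of_nat m) * zeta s0))) \<in> O[at s0](\<lambda>s. s - s0)"
proof -
  \<comment> \<open>Here \<open>Re s0 + M = 4 > 3\<close>; moreover \<open>M > 2 * m\<close>, so the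
    error vanishes at \<open>s0\<close> and the singular index \<open>2 * m\<close> lies in the
    sum.\<close>
  define M where "M = 2 * m + 3"
  have M: "M \<ge> 2" "Re s0 + of_nat M > 3" by (auto simp: M_def s0_def)
  define k where "k = 2 * m - 1"
  have k: "2 * m = Suc k" "k \<ge> 1" using m by (auto simp: k_def)
  have s0: "s0 = - of_nat k"
  proof -
    have "(2 * of_nat m :: complex) = of_nat (Suc k)" unfolding k(1) [symmetric] by simp
    then show ?thesis by (simp add: s0_def)
  qed
  have s0_1: "s0 - 1 = - of_nat (Suc k)" by (simp add: s0)
  have "s0 \<noteq> 1" using s0_1 by (metis diff_self neg_equal_0_iff_equal of_nat_eq_0_iff nat.distinct(1))
  define t where "t = (\<lambda>i s. bern_coeff i * pochhammer (s - 1) i * zeta (s + of_nat i))"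
  \<comment> \<open>At \<open>s0 = -k\<close> the argument \<open>s + i\<close> of zeta hits the
    pole 1 exactly for \<open>i = Suc k\<close>; \<open>I\<close> holds the regular indices.\<close>
  define I where "I = {..<M} - {Suc k}"
  define R where "R = (\<lambda>s. ((\<Sum>i\<in>I. t i s) + harmonic_em.em_sum M s) / (s - 1))"
  \<comment> \<open>The singular term divided by \<open>s - 1\<close> and multiplied by
    \<open>s - s0\<close>: \<open>pochhammer (s - 1) (Suc k)\<close> supplies the factor
    \<open>s - 1\<close>, and the numerator of zeta replaces its pole. Thus \<open>T\<close> is
    \<open>s - s0\<close> times the harmonic zeta function near \<open>s0\<close>.\<close>
  define Q where "Q = (\<lambda>s. bern_coeff (Suc k) * (pochhammer s k * zeta_em.em_numer 3 (s + of_nat (Suc k))))"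
  define T where "T = (\<lambda>s. (s - s0) * R s + Q s)"

  have zeta_shift: "(\<lambda>s. zeta (s + of_nat i)) analytic_on {s0}" if "i \<noteq> Suc k" for i
  proof -
    have "s0 + of_nat i = 1 \<longleftrightarrow> (of_nat i :: complex) = of_nat (Suc k)"
      by (auto simp: s0 algebra_simps)
    then have "s0 + of_nat i \<noteq> 1" using that by (simp only: of_nat_eq_iff not_False_eq_True)
    then have "zeta analytic_on (\<lambda>s. s + of_nat i) ` {s0}"
      by (auto intro!: zeta_analytic)
    moreover have "(\<lambda>s. s + of_nat i) analytic_on {s0}" by (intro analytic_intros)
    ultimately show ?thesis
      using analytic_on_compose [of "\<lambda>s. s + of_nat i" "{s0}" zeta] by (simp add: o_def)
  qed
  have R: "R analytic_on {s0}"
    using \<open>s0 \<noteq> 1\<close> unfolding R_def t_def pochhammer_prod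
    by (intro analytic_intros zeta_shift harmonic_em.em_sum_analytic M) (auto simp: I_def)
  have zeta_em: "(\<lambda>s. zeta_em.em_numer 3 (s + of_nat (Suc k))) analytic_on {s0}"
  proof -
    have "zeta_em.em_numer 3 analytic_on {1}"
      unfolding zeta_em.em_numer_def pochhammer_prod
      by (intro analytic_intros zeta_em.em_sum_analytic) auto
    moreover have "(\<lambda>s. s + of_nat (Suc k)) analytic_on {s0}" by (intro analytic_intros)
    ultimately show ?thesis
      using analytic_on_compose [of "\<lambda>s. s + of_nat (Suc k)" "{s0}" "zeta_em.em_numer 3"]
      by (simp add: o_def s0)
  qed
  then have Q: "Q analytic_on {s0}"
    unfolding Q_def pochhammer_prod by (intro analytic_intros)
  have T: "T analytic_on {s0}"
    unfolding T_def by (intro analytic_intros R Q)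

  have zeta_s0: "zeta s0 = - fact k * bern_coeff (Suc k)"
    unfolding s0 by (rule zeta_minus_of_nat)
  have poch_s0: "pochhammer s0 k = - fact k"
  proof -
    have "odd k" using k by presburger
    then show ?thesis unfolding s0 by (subst pochhammer_minus_of_nat) auto
  qed

  have ze: "zeta_em.em_numer 3 (s0 + of_nat (Suc k)) = 1"
    using zeta_em_numer_1 by (simp add: s0)
  have harm_sum: "(\<Sum>i<k. 1 / (s0 + of_nat i)) = - harm k"
  proof -
    \<comment> \<open>Read backwards, the denominators \<open>i - k\<close> are
      \<open>-1, ..., -k\<close>.\<close>
    have "(\<Sum>i<k. 1 / (s0 + of_nat i)) = (\<Sum>i<k. - inverse (of_nat (Suc i)))"
      by (subst sum.nat_diff_reindex [symmetric], rule sum.cong)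
         (auto simp: s0 of_nat_diff divide_simps)
    then show ?thesis by (simp add: sum_negf harm_altdef del: of_nat_Suc)
  qed
  have "((\<lambda>s. pochhammer s k) has_field_derivative pochhammer s0 k * (- harm k)) (at s0)"
    unfolding harm_sum [symmetric]
    by (rule has_field_derivative_pochhammer) (auto simp: s0)
  moreover have "((\<lambda>s. zeta_em.em_numer 3 (s + of_nat (Suc k))) has_field_derivative euler_mascheroni * 1) (at s0)"
  proof (rule DERIV_chain2 [where f = "zeta_em.em_numer 3" and g = "\<lambda>s. s + of_nat (Suc k)"])
    have "s0 + of_nat (Suc k) = 1" by (simp add: s0)
    with has_field_derivative_zeta_em_numer_1
    show "(zeta_em.em_numer 3 has_field_derivative euler_mascheroni) (at (s0 + of_nat (Suc k)))"
      by (simp only:)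
    show "((\<lambda>s. s + of_nat (Suc k)) has_field_derivative 1) (at s0)"
      by (auto intro!: derivative_eq_intros)
  qed
  ultimately have Q'': "(Q has_field_derivative bern_coeff (Suc k) *
      (pochhammer s0 k * (- harm k) * zeta_em.em_numer 3 (s0 + of_nat (Suc k)) + (euler_mascheroni * 1) * pochhammer s0 k)) (at s0)"
    unfolding Q_def by (rule DERIV_cmult [OF DERIV_mult])
  \<comment> \<open>The logarithmic derivative \<open>- harm k\<close> of the Pochhammer factor and
    \<gamma> from zeta combine to \<open>- Digamma (k + 1)\<close>; the common factor is
    \<open>zeta s0\<close>.\<close>
  have "bern_coeff (Suc k) *
      (pochhammer s0 k * (- harm k) * zeta_em.em_numer 3 (s0 + of_nat (Suc k)) + (euler_mascheroni * 1) * pochhammer s0 k)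
      = - Digamma (2 * of_nat m) * zeta s0"
  proof -
    have "(2 * of_nat m :: complex) = of_nat (Suc k)" unfolding k(1) [symmetric] by simp
    then have dg: "Digamma (2 * of_nat m :: complex) = harm k - euler_mascheroni"
      by (simp only: Digamma_of_nat)
    show ?thesis unfolding dg ze zeta_s0 poch_s0 by (simp add: algebra_simps)
  qed
  then have Q': "(Q has_field_derivative - Digamma (2 * of_nat m) * zeta s0) (at s0)"
    by (rule DERIV_cong [OF Q''])
  have "(R has_field_derivative deriv R s0) (at s0)"
    using R by (simp add: analytic_on_imp_differentiable_at DERIV_deriv_iff_field_differentiable)
  then have "((\<lambda>s. (s - s0) * R s) has_field_derivative R s0) (at s0)"
    by (auto intro!: derivative_eq_intros)
  from DERIV_add [OF this Q']
  have T': "(T has_field_derivative R s0 + - Digamma (2 * of_nat m) * zeta s0) (at s0)"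
    unfolding T_def .
  have T_s0: "T s0 = zeta s0"
    by (simp add: T_def Q_def poch_s0 zeta_s0 ze del: of_nat_Suc)

  \<comment> \<open>Only indices below \<open>2 * m\<close> survive at \<open>s0\<close>. There zeta
    is taken at \<open>-j\<close> with \<open>j = k - i\<close>, and the sign of the Pochhammer
    symbol turns \<open>bern_coeff i\<close> into \<open>bernoulli i / i!\<close>.\<close>
  have R_s0: "R s0 = fact k * (\<Sum>i<Suc k. bernoulli i / fact i * (bern_coeff (Suc k - i) / of_nat (Suc k - i)))"
  proof -
    have p0: "pochhammer (s0 - 1) i = 0" if "i > Suc k" for i
      unfolding s0_1 using that by (rule pochhammer_of_nat_eq_0_lemma)
    have "harmonic_em.em_sum M s0 = 0"
      using M by (intro harmonic_em.em_sum_eq_0 p0) (auto simp: M_def k)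
    moreover have "(\<Sum>i\<in>I. t i s0) = (\<Sum>i<Suc k. t i s0)"
      by (rule sum.mono_neutral_right) (auto simp: I_def M_def k t_def intro!: p0)
    ultimately have "R s0 = (\<Sum>i<Suc k. t i s0) / (s0 - 1)"
      by (simp add: R_def)
    also have "\<dots> = (\<Sum>i<Suc k. t i s0 / (s0 - 1))"
      by (rule sum_divide_distrib)
    also have "\<dots> = (\<Sum>i<Suc k. fact k * (bernoulli i / fact i * (bern_coeff (Suc k - i) / of_nat (Suc k - i))))"
    proof (rule sum.cong)
      fix i assume "i \<in> {..<Suc k}"
      then obtain j where j: "k = i + j" by (auto simp: less_Suc_eq_le le_iff_add)
      have "zeta (s0 + of_nat i) = - fact j * bern_coeff (Suc j)"
        using zeta_minus_of_nat [of j] by (simp add: s0 j)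
      moreover have "pochhammer (s0 - 1) i = (-1) ^ i * fact (Suc k) / fact (Suc j)"
        unfolding s0_1 using pochhammer_minus_of_nat [of i "Suc k"] by (simp add: j del: of_nat_Suc fact_Suc)
      ultimately have "t i s0 = - ((-1) ^ i * bern_coeff i) * fact (Suc k) / fact (Suc j) * fact j * bern_coeff (Suc j)"
        by (simp add: t_def)
      then have "t i s0 / (s0 - 1) = (bernoulli i / fact i) * (fact (Suc k) / of_nat (Suc k)) * (fact j / fact (Suc j)) * bern_coeff (Suc j)"
        unfolding bern_coeff_uminus s0_1 by (simp del: of_nat_Suc fact_Suc)
      also have "fact (Suc k) / of_nat (Suc k) = (fact k :: complex)"
        unfolding fact_Suc by (simp del: of_nat_Suc)
      also have "fact j / fact (Suc j) = (1 / of_nat (Suc j) :: complex)"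
        unfolding fact_Suc by (simp del: of_nat_Suc)
      finally show "t i s0 / (s0 - 1) = fact k * (bernoulli i / fact i * (bern_coeff (Suc k - i) / of_nat (Suc k - i)))"
        by (simp add: j Suc_diff_le del: of_nat_Suc)
    qed simp
    finally show ?thesis by (simp only: sum_distrib_left)
  qed

  have "eventually (\<lambda>s. harmonic_zeta s = T s / (s - s0)) (at s0)"
  proof -
    have "eventually (\<lambda>s. s \<noteq> 1) (nhds s0)"
      using \<open>s0 \<noteq> 1\<close> by (rule t1_space_nhds)
    then have "eventually (\<lambda>s. s \<noteq> 1) (at s0)" by (simp add: eventually_nhds_conv_at)
    \<comment> \<open>Radius 1 keeps the real part of \<open>u = s + Suc k\<close> positive, as
      order 3 requires for zeta at \<open>u\<close>.\<close>
    moreover have "eventually (\<lambda>s. s \<in> ball s0 1 - {s0}) (at s0)"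
      by (intro eventually_at_in_open) auto
    ultimately show ?thesis
      using harmonic_em.eventually_remove_sings_continuation_eq [OF M]
    proof eventually_elim
      case (elim s)
      define u where "u = s + of_nat (Suc k)"
      have u: "u - 1 = s - s0" by (simp add: u_def s0)
      have "\<bar>Re (s - s0)\<bar> < 1"
        using elim abs_Re_le_cmod [of "s - s0"] by (simp add: dist_norm norm_minus_commute)
      then have "Re u > 0" unfolding u [symmetric] by simp
      moreover have "u \<noteq> 1" using u elim by auto
      ultimately have "zeta u = zeta_em.em_numer 3 u / (s - s0)"
        unfolding u [symmetric] by (intro zeta_eq_em_numer) auto
      moreover have "pochhammer (s - 1) (Suc k) = (s - 1) * pochhammer s k"
        by (simp add: pochhammer_rec)
      ultimately have tk: "t (Suc k) s = (s - 1) * Q s / (s - s0)"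
        by (simp add: t_def Q_def u_def)
      have "harmonic_em.em_numer M s = (\<Sum>i<M. t i s) + harmonic_em.em_sum M s"
        by (simp add: harmonic_em.em_numer_def t_def)
      also have "(\<Sum>i<M. t i s) = t (Suc k) s + (\<Sum>i\<in>I. t i s)"
        unfolding I_def by (rule sum.remove) (auto simp: M_def k)
      finally have "harmonic_em.em_numer M s / (s - 1) = R s + Q s / (s - s0)"
        using elim(1) unfolding tk R_def by (simp add: add_divide_distrib)
      also have "\<dots> = T s / (s - s0)"
        using elim(2) unfolding T_def by (simp add: add_divide_distrib)
      finally show ?case
        using elim(3) by (simp add: harmonic_zeta_conv_remove_sings)
    qed
  qed
  from simple_pole_expansion_bigo [OF this T T'] show ?thesis
    unfolding T_s0 R_s0 k(1) by (simp only: diff_Suc_1 minus_mult_left diff_conv_add_uminus)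
qed

section \<open>Identification of \<open>A_coeff\<close> and the two final expansions\<close>

lemma A_coeff_eq:
  assumes "m \<ge> 2"
  shows "(\<Sum>i<2*m. bernoulli i / fact i * (bern_coeff (2 * m - i) / of_nat (2 * m - i))) = A_coeff (2 * m)"
proof -
  \<comment> \<open>At an odd index other than 1, \<open>bern_coeff_uminus\<close> and
    \<open>bern_coeff_eq\<close> make the coefficient equal to its own negative. It is the partner
    of \<open>i = 1\<close>, the only index where the two convolutions differ.\<close>
  have odd: "bern_coeff (2 * m - 1) = 0"
  proof -
    have "odd (2 * m - 1)" "2 * m - 1 \<noteq> 1" using assms by auto
    then show ?thesis
      using bern_coeff_uminus [of "2 * m - 1"] bern_coeff_eq [of "2 * m - 1"]
      by (simp add: eq_neg_iff_add_eq_0)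
  qed
  have "A_coeff n = (\<Sum>i<n. bern_coeff (n - i) / of_nat (n - i) * bern_coeff i)" for n
    unfolding A_coeff_def
    by (rule sum.reindex_bij_witness [of _ "\<lambda>i. (n - i, i)" snd]) (auto simp: bern_coeff_def)
  then have "A_coeff (2 * m) = (\<Sum>i<2*m. bern_coeff (2 * m - i) / of_nat (2 * m - i) * bern_coeff i)" .
  also have "\<dots> = (\<Sum>i<2*m. bernoulli i / fact i * (bern_coeff (2 * m - i) / of_nat (2 * m - i)))"
  proof (rule sum.cong)
    show "bern_coeff (2 * m - i) / of_nat (2 * m - i) * bern_coeff i =
       bernoulli i / fact i * (bern_coeff (2 * m - i) / of_nat (2 * m - i))" for i
      using odd by (cases "i = 1") (auto simp: bern_coeff_eq [of i] mult.commute)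
  qed simp
  finally show ?thesis ..
qed

theorem corollary3:
  shows "(\<forall>m::nat. m \<ge> 2 \<longrightarrow>
            (\<lambda>s. harmonic_zeta s -
                   (zeta (1 - 2 * of_nat m) / (s + 2 * of_nat m - 1)
                    + fact (2 * m - 1) * A_coeff (2 * m)
                    - Digamma (2 * of_nat m) * zeta (1 - 2 * of_nat m)))
              \<in> O[at (1 - 2 * of_nat m)](\<lambda>s. s + 2 * of_nat m - 1))
       \<and> (\<lambda>s. harmonic_zeta s - ((-1) / (12 * (s + 1)) - 1 / 8 - euler_mascheroni / 12))
              \<in> O[at (-1)](\<lambda>s. s + 1)"
proof (intro conjI allI impI)
  fix m :: nat assume m: "m \<ge> 2"
  have "s - (1 - 2 * of_nat m) = s + 2 * of_nat m - 1" for s :: complex by simp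
  with harmonic_zeta_expansion [of m] m
  show "(\<lambda>s. harmonic_zeta s -
                   (zeta (1 - 2 * of_nat m) / (s + 2 * of_nat m - 1)
                    + fact (2 * m - 1) * A_coeff (2 * m)
                    - Digamma (2 * of_nat m) * zeta (1 - 2 * of_nat m)))
              \<in> O[at (1 - 2 * of_nat m)](\<lambda>s. s + 2 * of_nat m - 1)"
    unfolding A_coeff_eq [OF m] by (simp only: add_diff_eq)
next
  have z: "zeta (-1) = - (1 / 12)"
    using zeta_minus_of_nat [of 1] bern_coeff_simps(3) by (simp add: numeral_2_eq_2)
  have d: "Digamma (2 :: complex) = 1 - euler_mascheroni"
    using Digamma_of_nat [of 1, where ?'a = complex] by (simp add: harm_def)
  \<comment> \<open>The two terms are \<open>1/24\<close> and \<open>-1/4\<close>. Adding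
    \<open>(1 - \<gamma>) / 12\<close> from the digamma term gives the constant
    \<open>-1/8 - \<gamma>/12\<close>.\<close>
  have sum: "(\<Sum>i<2. bernoulli i / fact i * (bern_coeff (2 - i) / of_nat (2 - i))) = - (5 / 24)"
    by (simp add: numeral_2_eq_2 bernoulli_0 bernoulli_1 [simplified] bern_coeff_simps(2)
          bern_coeff_simps(3) [unfolded numeral_2_eq_2])
  have eq: "zeta (-1) / (s - (-1)) + (fact (2 - 1) * - (5 / 24) - Digamma 2 * zeta (-1))
      = (-1) / (12 * (s + 1)) - 1 / 8 - euler_mascheroni / 12" for s
  proof -
    have "- (1 / 12) / (s + 1) = (-1) / (12 * (s + 1))"
      by (simp only: minus_divide_left divide_divide_eq_left)
    then show ?thesis
      unfolding z d diff_minus_eq_add by (simp add: diff_divide_distrib)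
  qed
  show "(\<lambda>s. harmonic_zeta s - ((-1) / (12 * (s + 1)) - 1 / 8 - euler_mascheroni / 12))
              \<in> O[at (-1)](\<lambda>s. s + 1)"
  proof -
    have "2 * of_nat 1 = (2 :: complex)" "1 - 2 = (-1 :: complex)" "2 * 1 = (2 :: nat)" by simp_all
    note harmonic_zeta_expansion [OF order_refl, unfolded this sum eq]
    then show ?thesis by (simp only: diff_minus_eq_add)
  qed
qed

end
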